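(* Let $\mathcal{A}=\{1,\dots,A\}$ and $\mathcal{Y}=\{1,\dots,Y\}$ be finite sets, $\overline{\mathcal{Y}}=\mathcal{Y}\cup\{o\}$, and let $\Delta>0$. Suppose that the network on $\mathcal{A}$ is such that every person has at least one friend ($|\mathcal{N}_a|>0$ for each $a\in\mathcal{A}$), that the researcher knows the rates $\lambda=(\lambda_a)_{a\in\mathcal{A}}$, $\lambda_a>0$, and knows $\mathcal{P}(\Delta)=e^{\Delta\mathcal{M}}$ (Dataset 2), and that $\mathcal{M}$ has distinct eigenvalues that do not differ by an integer multiple of $2\pi i/\Delta$ (where $i$ is the imaginary unit). Then the conditional choice probabilities $\operatorname{P}=(\operatorname{P}_a)_{a\in\mathcal{A}}$ are generically identified from $\mathcal{P}(\Delta)$. That is, let $\mathscr{P}$ be the set of profiles $\operatorname{P}$ whose transition rate matrix $\mathcal{M}(\operatorname{P})$ (with the given $\lambda$) satisfies the eigenvalue condition; then there is a Lebesgue-null set $E$ such that for all $\operatorname{P}\in\mathscr{P}\setminus E$ and all $\operatorname{P}'\in\mathscr{P}$, $e^{\Delta\mathcal{M}(\operatorname{P}')}=e^{\Delta\mathcal{M}(\operatorname{P})}$ implies $\operatorname{P}'=\operatorname{P}$.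
   Context: A network is a directed graph without loops on $\mathcal{A}$; $\mathcal{N}_a=\{a'\ne a:\text{ there is an edge from } a\text{ to }a'\}$ is the set of friends of $a$. $o\notin\mathcal{Y}$ is a default option. A profile of conditional choice probabilities $\operatorname{P}=(\operatorname{P}_a)_{a\in\mathcal{A}}$ consists of functions $\operatorname{P}_a(v\mid\mathbf{y}):\overline{\mathcal{Y}}\times\overline{\mathcal{Y}}^A\to(0,1)$ with $\sum_{v\in\overline{\mathcal{Y}}}\operatorname{P}_a(v\mid\mathbf{y})=1$; the set of such profiles is identified (dropping $v=o$) with an open subset of $\mathbb{R}^{A\cdot Y\cdot(Y+1)^A}$, and "Lebesgue-null" refers to Lebesgue measure there. In the model these have the form $\operatorname{P}_a(v\mid\mathbf{y})=\operatorname{Q}_a(v\mid\mathbf{y})\prod_{v'\in\mathcal{Y},\,v'\succ_a v}(1-\operatorname{Q}_a(v'\mid\mathbf{y}))$ for $v\in\mathcal{Y}$ and $\operatorname{P}_a(o\mid\mathbf{y})=\prod_{v\in\mathcal{Y}}(1-\operatorname{Q}_a(v\mid\mathbf{y}))$, with strict preference orders $\succ_a$ on $\mathcal{Y}$ and attention probabilities $\operatorname{Q}_a(v\mid\mathbf{y})\in(0,1)$ (which, for any fixed $\succ_a$, imposes no restriction on $\operatorname{P}_a$). The transition rate matrix $\mathcal{M}=\mathcal{M}(\operatorname{P})$ is indexed by $\overline{\mathcal{Y}}^A\times\overline{\mathcal{Y}}^A$ with $(\mathbf{y},\mathbf{y}')$ entry $\operatorname{m}(\mathbf{y}'\mid\mathbf{y})$,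 where for $\mathbf{y}'\neq\mathbf{y}$: $\operatorname{m}(\mathbf{y}'\mid\mathbf{y})=0$ if $\mathbf{y},\mathbf{y}'$ differ in more than one component, $\operatorname{m}(\mathbf{y}'\mid\mathbf{y})=\lambda_a\operatorname{P}_a(y_a'\mid\mathbf{y})$ if they differ exactly in component $a$; and $\operatorname{m}(\mathbf{y}\mid\mathbf{y})=-\sum_{\mathbf{y}'\neq\mathbf{y}}\operatorname{m}(\mathbf{y}'\mid\mathbf{y})$. *)

theory Defs
  imports "HOL-Analysis.Analysis"
begin

text \<open>
  The finite type \<open>'a\<close> is the set of people and the finite type \<open>'y\<close> the set of alternatives.
  The alternatives together with the default form \<open>'y option\<close>, where \<^const>\<open>None\<close> is the default \<open>o\<close>.
\<close>

type_synonym ('a, 'y) config = "'a \<Rightarrow> 'y option"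

definition friends :: "('a \<times> 'a) set \<Rightarrow> 'a \<Rightarrow> 'a set" where
  "friends network a = {a'. a' \<noteq> a \<and> (a, a') \<in> network}"

text \<open>\<open>P a v y\<close> is the probability that person \<open>a\<close> picks \<open>v\<close> when the current configuration is \<open>y\<close>.\<close>

type_synonym ('a, 'y) profile = "'a \<Rightarrow> 'y option \<Rightarrow> ('a, 'y) config \<Rightarrow> real"

definition ccp_profile :: "('a::finite, 'y::finite) profile \<Rightarrow> bool" where
  "ccp_profile P \<longleftrightarrow>
     (\<forall>a v y. 0 < P a v y \<and> P a v y < 1) \<and> (\<forall>a y. (\<Sum>v\<in>UNIV. P a v y) = 1)"

text \<open>The coordinates of a profile, the redundant entries \<open>v = o\<close> being dropped.\<close>

definition profile_coords ::
    "('a::finite, 'y::finite) profile \<Rightarrow> real ^ ('a \<times> 'y \<times> ('a, 'y) config)" where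
  "profile_coords P = (\<chi> i. case i of (a, v, y) \<Rightarrow> P a (Some v) y)"

text \<open>\<open>transition_rate rate P y' y\<close> is \<open>m(y' | y)\<close> for \<open>y' \<noteq> y\<close>; the value on the diagonal is irrelevant.\<close>

definition transition_rate ::
    "('a \<Rightarrow> real) \<Rightarrow> ('a, 'y) profile \<Rightarrow> ('a, 'y) config \<Rightarrow> ('a, 'y) config \<Rightarrow> real" where
  "transition_rate rate P y' y =
     (if \<exists>!a. y' a \<noteq> y a then (let a = (THE a. y' a \<noteq> y a) in rate a * P a (y' a) y) else 0)"

definition rate_matrix ::
    "('a::finite \<Rightarrow> real) \<Rightarrow> ('a, 'y::finite) profile \<Rightarrow> real ^ ('a, 'y) config ^ ('a, 'y) config" where
  "rate_matrix rate P =
     (\<chi> y y'. if y' = y then - (\<Sum>z\<in>UNIV - {y}. transition_rate rate P z y)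
              else transition_rate rate P y' y)"

text \<open>
  The library's multiplication \<open>*\<close> on \<^type>\<open>vec\<close> is componentwise, so powers have to be
  formed with the matrix product \<open>**\<close>.
\<close>

definition matrix_pow :: "real ^ 'n ^ 'n \<Rightarrow> nat \<Rightarrow> real ^ 'n ^ 'n" where
  "matrix_pow M k = (((**) M) ^^ k) (mat 1)"

definition matrix_exp :: "real ^ 'n ^ 'n \<Rightarrow> real ^ 'n ^ 'n" where
  "matrix_exp M = (\<Sum>k. (1 / fact k) *\<^sub>R matrix_pow M k)"

definition eigenvalues :: "real ^ 'n ^ 'n \<Rightarrow> complex set" where
  "eigenvalues M = {\<mu>. \<exists>v::complex ^ 'n. v \<noteq> 0 \<and> map_matrix complex_of_real M *v v = \<mu> *s v}"

text \<open>
  ``Distinct eigenvalues'' refers to eigenvalues counted with multiplicity: a matrix with \<open>n\<close> rows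
  has \<open>n\<close> different ones.
\<close>

definition distinct_eigenvalues :: "real ^ 'n ^ 'n \<Rightarrow> bool" where
  "distinct_eigenvalues M \<longleftrightarrow> card (eigenvalues M) = CARD('n)"

definition eigenvalue_condition :: "real \<Rightarrow> real ^ 'n ^ 'n \<Rightarrow> bool" where
  "eigenvalue_condition \<Delta> M \<longleftrightarrow>
     distinct_eigenvalues M \<and>
     (\<forall>\<mu>\<in>eigenvalues M. \<forall>\<nu>\<in>eigenvalues M. \<mu> \<noteq> \<nu> \<longrightarrow>
        \<not> (\<exists>k::int. \<mu> - \<nu> = of_int k * (2 * of_real pi * \<i> / of_real \<Delta>)))"

definition admissible_profiles ::
    "real \<Rightarrow> ('a::finite \<Rightarrow> real) \<Rightarrow> ('a, 'y::finite) profile set" where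
  "admissible_profiles \<Delta> rate = {P. ccp_profile P \<and> eigenvalue_condition \<Delta> (rate_matrix rate P)}"

end

theory Submission
  imports Defs
begin

text \<open>
  If \<open>M\<close> satisfies the eigenvalue condition and \<open>e\<^bsup>\<Delta>M'\<^esup> = e\<^bsup>\<Delta>M\<^esup>\<close>, then \<open>M'\<close> preserves the
  one-dimensional eigenspaces of \<open>e\<^bsup>\<Delta>M\<^esup>\<close>, so it commutes with \<open>M\<close>, and the eigenvalues of \<open>M\<close>
  and \<open>M'\<close> have equal real parts, so the traces agree. Hence \<open>D = M' - M\<close> commutes with \<open>M\<close>, has
  trace zero and zero row sums, and vanishes at pairs of configurations that differ in more than one
  component. These are linear equations in \<open>D\<close> whose coefficients are affine in \<open>P\<close>. If they force
  \<open>D = 0\<close> for a single real parameter vector, which need not consist of probabilities, they do so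
  outside the zero set of a nonzero polynomial, which is null.

  Such a parameter vector is given by a tree of configurations directed to an absorbing root, with
  distinct rates, in which the root has a single child and consecutive steps move different people.
\<close>

subsection \<open>Zero sets of polynomials\<close>

lemma finite_roots_real_polynomial_function:
  fixes q :: "real \<Rightarrow> real"
  assumes "real_polynomial_function q" "q s \<noteq> 0"
  shows "finite {t. q t = 0}"
proof -
  obtain a n where q: "q = (\<lambda>x. \<Sum>i\<le>n. a i * x ^ i)"
    using assms(1) real_polynomial_function_iff_sum by auto
  have "\<exists>i\<le>n. a i \<noteq> 0"
    using assms(2) by (auto simp: q intro: ccontr)
  then show ?thesis
    using polyfun_finite_roots[of a n] by (simp add: q)
qed

text \<open>
  On each line through a point where the polynomial does not vanish there are finitely many zeros.
  By Tonelli, almost every dilation of the zero set around that point is null, so one of them is.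
\<close>

lemma negligible_zeros_real_polynomial_function:
  fixes f :: "'a::euclidean_space \<Rightarrow> real"
  assumes f: "real_polynomial_function f" and x0: "f x0 \<noteq> 0"
  shows "negligible {x. f x = 0}"
proof -
  have cont: "continuous_on UNIV f"
    by (metis continuous_on_polymonial_function f real_polynomial_function_eq)
  have line: "AE t in lborel. f (x0 + t *\<^sub>R x) \<noteq> 0" for x
  proof -
    have "polynomial_function (\<lambda>t::real. x0 + t *\<^sub>R x)"
      by (intro polynomial_function_add polynomial_function_const polynomial_function_bounded_linear
          bounded_linear_scaleR_left)
    then have "real_polynomial_function (f \<circ> (\<lambda>t. x0 + t *\<^sub>R x))"
      using f by blast
    then have "finite {t. f (x0 + t *\<^sub>R x) = 0}"
      using finite_roots_real_polynomial_function[of _ 0] x0 by (force simp: o_def)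
    then have "{t. f (x0 + t *\<^sub>R x) = 0} \<in> null_sets lborel"
      by (simp add: finite_imp_null_set_lborel)
    from AE_not_in[OF this] show ?thesis
      by simp
  qed
  \<comment> \<open>Openness gives the joint measurability needed to swap the two almost-everywhere
    quantifiers.\<close>
  have "open {p :: 'a \<times> real. f (x0 + snd p *\<^sub>R fst p) \<noteq> 0}"
    by (intro open_Collect_neq continuous_on_compose2[OF cont] continuous_intros) auto
  then have meas: "{p \<in> space (lborel \<Otimes>\<^sub>M lborel). f (x0 + snd p *\<^sub>R fst p) \<noteq> 0}
      \<in> sets (lborel \<Otimes>\<^sub>M (lborel :: real measure))"
    unfolding lborel_prod by simp
  have "AE x in lborel. AE t in lborel. f (x0 + t *\<^sub>R x) \<noteq> 0"
    using line by simp
  then have "AE t in lborel. AE x in lborel. f (x0 + t *\<^sub>R x) \<noteq> 0"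
    using lborel_pair.AE_commute[of "\<lambda>x t. f (x0 + t *\<^sub>R x) \<noteq> 0"] meas by auto
  moreover have "AE t in lborel. t \<noteq> (0::real)"
    by (rule AE_lborel_singleton)
  \<comment> \<open>Since this filter is not \<open>bot\<close>, a property that holds for almost
    every \<open>t\<close> has an actual witness.\<close>
  moreover have nontriv: "ae_filter (lborel :: real measure) \<noteq> bot"
    by (auto simp: trivial_limit_def eventually_ae_filter null_sets_def top.extremum_unique)
  ultimately have "AE t in lborel. t \<noteq> (0::real) \<and> (AE x in lborel. f (x0 + t *\<^sub>R x) \<noteq> 0)"
    by auto
  then obtain t :: real where t: "t \<noteq> 0" "AE x in lborel. f (x0 + t *\<^sub>R x) \<noteq> 0"
    using eventually_happens'[OF nontriv] by blast
  moreover have "closed {x. f (x0 + t *\<^sub>R x) = 0}"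
    by (intro closed_Collect_eq continuous_on_compose2[OF cont] continuous_intros) auto
  ultimately have "negligible {x. f (x0 + t *\<^sub>R x) = 0}"
    using AE_iff_null_sets[of "{x. f (x0 + t *\<^sub>R x) = 0}" lborel]
    by (auto simp: negligible_iff_null_sets intro: null_sets_completionI)
  then have "negligible ((\<lambda>x. x0 + t *\<^sub>R x) ` {x. f (x0 + t *\<^sub>R x) = 0})"
    by (intro negligible_differentiable_image_negligible) (auto intro!: derivative_intros)
  moreover have "{x. f x = 0} \<subseteq> (\<lambda>x. x0 + t *\<^sub>R x) ` {x. f (x0 + t *\<^sub>R x) = 0}"
  proof
    fix x assume "x \<in> {x. f x = 0}"
    then show "x \<in> (\<lambda>x. x0 + t *\<^sub>R x) ` {x. f (x0 + t *\<^sub>R x) = 0}"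
      using t(1) by (intro image_eqI[of _ _ "(x - x0) /\<^sub>R t"]) auto
  qed
  ultimately show ?thesis
    using negligible_subset by blast
qed

text \<open>
  With a left inverse \<open>g\<close> of \<open>T p0\<close>, the determinant of \<open>g \<circ> T p\<close> is a polynomial in \<open>p\<close>
  that does not vanish at \<open>p0\<close>.
\<close>

lemma negligible_not_inj_polynomial_family:
  fixes T :: "'p::euclidean_space \<Rightarrow> real ^ 'k::finite \<Rightarrow> 'c::euclidean_space"
  assumes lin: "\<And>p. linear (T p)" and poly: "\<And>x. polynomial_function (\<lambda>p. T p x)"
    and inj: "inj (T p0)"
  shows "negligible {p. \<not> inj (T p)}"
proof -
  obtain g where g: "linear g" "g \<circ> T p0 = id"
    using linear_injective_left_inverse[OF lin inj] by blast
  define f where "f p = det (matrix (g \<circ> T p))" for p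
  have "real_polynomial_function (\<lambda>p. g (T p x) $ i)" for x i
  proof -
    have "bounded_linear (\<lambda>x. g x $ i)"
      by (intro bounded_linear_vec_nth[THEN bounded_linear_compose] linear_conv_bounded_linear[THEN iffD1] g)
    then show ?thesis
      using poly[of x] unfolding polynomial_function_def by (auto simp: o_def)
  qed
  then have "real_polynomial_function f"
    unfolding f_def[abs_def] det_def matrix_def o_def 
    by (intro real_polynomial_function_sum real_polynomial_function_prod real_polynomial_function.intros(2,4)
        finite_permutations) (simp_all)
  moreover have "f p0 \<noteq> 0"
    by (simp add: f_def g(2)  matrix_id_mat_1)
  ultimately have "negligible {p. f p = 0}"
    by (rule negligible_zeros_real_polynomial_function)
  moreover have "inj (T p)" if "f p \<noteq> 0" for p
    using that det_nz_iff_inj[of "g \<circ> T p"] linear_compose[OF lin g(1), of p] inj_on_imageI2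
    by (auto simp: f_def)
  ultimately show ?thesis
    by (elim negligible_subset) auto
qed

subsection \<open>Matrices with equal exponentials\<close>

lemma map_matrix_of_real_mult:
  fixes A :: "real ^ 'n ^ 'm" and B :: "real ^ 'k ^ 'n"
  shows "map_matrix complex_of_real (A ** B) = map_matrix complex_of_real A ** map_matrix complex_of_real B"
  by (simp add: vec_eq_iff matrix_matrix_mult_def)

lemma map_matrix_of_real_inject:
  "map_matrix complex_of_real A = map_matrix complex_of_real B \<longleftrightarrow> A = B"
  by (simp add: vec_eq_iff)

text \<open>Boundedness provides the norm estimate behind the convergence of the exponential series
  and allows products to be taken inside it.\<close>

lemma bounded_bilinear_matrix_mult:
  "bounded_bilinear ((**) :: real ^ 'n ^ 'm \<Rightarrow> real ^ 'k ^ 'n \<Rightarrow> real ^ 'k ^ 'm)"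
  by (simp add: bilinear_conv_bounded_bilinear[symmetric] bilinear_def linear_iff vec_eq_iff
      matrix_matrix_mult_def algebra_simps sum.distrib sum_distrib_left)

lemma matrix_pow_simps:
  "matrix_pow M 0 = mat 1" "matrix_pow M (Suc k) = M ** matrix_pow M k"
  by (simp_all add: matrix_pow_def)

lemma summable_matrix_exp:
  fixes M :: "real ^ 'n ^ 'n"
  shows "summable (\<lambda>k. (1 / fact k) *\<^sub>R matrix_pow M k)"
proof -
  obtain K where K: "K > 0" "\<And>(A :: real ^ 'n ^ 'n) (B :: real ^ 'n ^ 'n). norm (A ** B) \<le> norm A * norm B * K"
    using bounded_bilinear.pos_bounded[OF bounded_bilinear_matrix_mult] by blast
  have bound: "norm (matrix_pow M k) \<le> norm (mat 1 :: real ^ 'n ^ 'n) * (norm M * K) ^ k" for k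
  proof (induction k)
    case (Suc k)
    have "norm (matrix_pow M (Suc k)) \<le> (norm M * K) * norm (matrix_pow M k)"
      using K(2)[of M "matrix_pow M k"] by (simp add: matrix_pow_simps ac_simps)
    also have "\<dots> \<le> (norm M * K) * (norm (mat 1 :: real ^ 'n ^ 'n) * (norm M * K) ^ k)"
      using Suc K(1) by (intro mult_left_mono) auto
    finally show ?case
      by (simp add: ac_simps)
  qed (simp add: matrix_pow_simps)
  show ?thesis
  proof (rule summable_comparison_test')
    show "summable (\<lambda>k. norm (mat 1 :: real ^ 'n ^ 'n) * ((norm M * K) ^ k /\<^sub>R fact k))"
      by (intro summable_mult summable_exp_generic)
    show "norm ((1 / fact k) *\<^sub>R matrix_pow M k)
        \<le> norm (mat 1 :: real ^ 'n ^ 'n) * ((norm M * K) ^ k /\<^sub>R fact k)" for k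
      using bound[of k] by (simp add: divide_simps)
  qed
qed

lemma matrix_pow_commute: "M ** matrix_pow M k = matrix_pow M k ** M"
  by (induction k) (simp add: matrix_pow_simps, metis matrix_pow_simps(2) matrix_mul_assoc)

lemma matrix_exp_commute: "M ** matrix_exp M = matrix_exp M ** M"
proof -
  have "M ** matrix_exp M = (\<Sum>k. M ** ((1 / fact k) *\<^sub>R matrix_pow M k))"
    unfolding matrix_exp_def
    by (intro bounded_linear.suminf summable_matrix_exp
        bounded_bilinear.bounded_linear_right[OF bounded_bilinear_matrix_mult])
  also have "\<dots> = (\<Sum>k. ((1 / fact k) *\<^sub>R matrix_pow M k) ** M)"
    by (simp add: bounded_bilinear.scaleR_left[OF bounded_bilinear_matrix_mult]
        bounded_bilinear.scaleR_right[OF bounded_bilinear_matrix_mult] matrix_pow_commute)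
  also have "\<dots> = matrix_exp M ** M"
    unfolding matrix_exp_def
    by (intro bounded_linear.suminf[symmetric] summable_matrix_exp
        bounded_bilinear.bounded_linear_left[OF bounded_bilinear_matrix_mult])
  finally show ?thesis .
qed

lemma matrix_pow_eigenvector:
  fixes M :: "real ^ 'n ^ 'n"
  assumes "map_matrix complex_of_real M *v v = \<mu> *s v"
  shows "map_matrix complex_of_real (matrix_pow M k) *v v = \<mu> ^ k *s v"
proof (induction k)
  case 0
  have "map_matrix complex_of_real (mat 1) = (mat 1 :: complex ^ 'n ^ 'n)"
    by (simp add: vec_eq_iff mat_def)
  then show ?case
    by (simp add: matrix_pow_simps)
next
  case (Suc k)
  then show ?case
    using assms
    by (simp add: matrix_pow_simps map_matrix_of_real_mult vector_scalar_commute vector_smult_assoc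
        mult.commute flip: matrix_vector_mul_assoc)
qed

lemma matrix_exp_eigenvector:
  fixes M :: "real ^ 'n ^ 'n"
  assumes "map_matrix complex_of_real M *v v = \<mu> *s v"
  shows "map_matrix complex_of_real (matrix_exp M) *v v = exp \<mu> *s v"
proof -
  \<comment> \<open>For fixed complex \<open>v\<close> this map is real-linear in the real matrix
    \<open>X\<close>, so the series can be applied to \<open>v\<close> term by term.\<close>
  have lin: "bounded_linear (\<lambda>X :: real ^ 'n ^ 'n. map_matrix complex_of_real X *v v)"
    by (simp add: linear_conv_bounded_linear[symmetric] linear_iff vec_eq_iff matrix_vector_mult_def
        algebra_simps sum.distrib sum_distrib_left scaleR_conv_of_real[where 'a = complex])
  have pow: "map_matrix complex_of_real ((1 / fact k) *\<^sub>R matrix_pow M k) *v v = (\<mu> ^ k /\<^sub>R fact k) *s v"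
    for k
    using matrix_pow_eigenvector[OF assms, of k] linear_cmul[OF bounded_linear.linear[OF lin]]
    by (simp add: vec_eq_iff divide_inverse scaleR_conv_of_real[where 'a = complex])
  have "map_matrix complex_of_real (matrix_exp M) *v v =
      (\<Sum>k. map_matrix complex_of_real ((1 / fact k) *\<^sub>R matrix_pow M k) *v v)"
    unfolding matrix_exp_def by (intro bounded_linear.suminf[OF lin] summable_matrix_exp)
  also have "\<dots> = (\<Sum>k. (\<mu> ^ k /\<^sub>R fact k) *s v)"
    by (simp only: pow)
  also have "\<dots> = exp \<mu> *s v"
    unfolding exp_def
    by (intro bounded_linear.suminf[symmetric] summable_exp_generic)
      (simp add: linear_conv_bounded_linear[symmetric] linear_iff vec_eq_iff algebra_simps)
  finally show ?thesis .
qed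

section \<open>Diagonalisation over the complex numbers\<close>

definition diagonal_matrix :: "('n \<Rightarrow> 'a::zero) \<Rightarrow> 'a ^ 'n ^ 'n" where
  "diagonal_matrix d = (\<chi> i j. if i = j then d i else 0)"

lemma matrix_mult_diagonal_nth [simp]:
  fixes A :: "'a::semiring_1 ^ 'n ^ 'm"
  shows "(A ** diagonal_matrix d) $ i $ j = A $ i $ j * d j"
  by (simp add: matrix_matrix_mult_def diagonal_matrix_def if_distrib cong: if_cong)

lemma diagonal_matrix_mult_nth [simp]:
  fixes A :: "'a::semiring_1 ^ 'n ^ 'm"
  shows "(diagonal_matrix d ** A) $ i $ j = d i * A $ i $ j"
  by (simp add: matrix_matrix_mult_def diagonal_matrix_def if_distrib[of "\<lambda>x. x * _"] cong: if_cong)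

lemma matrix_mult_eq_diagonal_iff:
  fixes A :: "'a::comm_semiring_1 ^ 'n ^ 'n"
  shows "A ** V = V ** diagonal_matrix d \<longleftrightarrow> (\<forall>j. A *v column j V = d j *s column j V)"
  by (auto simp: vec_eq_iff matrix_matrix_mult_def matrix_vector_mult_def column_def
      diagonal_matrix_def if_distrib ac_simps cong: if_cong)

lemma trace_diagonal_matrix: "trace (diagonal_matrix d) = (\<Sum>i\<in>UNIV. d i)"
  by (simp add: trace_def diagonal_matrix_def)

text \<open>Applying \<open>A\<close> to the relation and subtracting \<open>\<mu> k\<close> times
  it removes \<open>v k\<close> and scales every other coefficient by the nonzero factor
  \<open>\<mu> j - \<mu> k\<close>.\<close>

lemma eigenvectors_independent:
  fixes A :: "'a::field ^ 'n ^ 'n"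
  assumes "finite S" "inj_on \<mu> S" "\<And>j. j \<in> S \<Longrightarrow> v j \<noteq> 0" "\<And>j. j \<in> S \<Longrightarrow> A *v v j = \<mu> j *s v j"
    and "(\<Sum>j\<in>S. x j *s v j) = 0"
  shows "\<forall>j\<in>S. x j = 0"
  using assms
proof (induction S arbitrary: x rule: finite_induct)
  case (insert k S)
  have "A *v (\<Sum>j\<in>insert k S. x j *s v j) = (\<Sum>j\<in>insert k S. (x j * \<mu> j) *s v j)"
    using insert.prems(3)
    by (simp add: vec.linear_sum[OF matrix_vector_mul_linear_gen] vector_scalar_commute vector_smult_assoc del: sum.insert)
  then have "0 = (\<Sum>j\<in>insert k S. (x j * \<mu> j) *s v j) - \<mu> k *s (\<Sum>j\<in>insert k S. x j *s v j)"
    using insert.prems(4) by simp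
  also have "\<dots> = (\<Sum>j\<in>insert k S. (x j * (\<mu> j - \<mu> k)) *s v j)"
    by (simp add: vec.scale_sum_right sum_subtractf[symmetric] vector_smult_assoc vec.scale_left_diff_distrib
        algebra_simps del: sum.insert)
  also have "\<dots> = (\<Sum>j\<in>S. (x j * (\<mu> j - \<mu> k)) *s v j)"
    using insert.hyps by simp
  finally have "\<forall>j\<in>S. x j * (\<mu> j - \<mu> k) = 0"
    using insert.prems by (intro insert.IH) (auto simp: inj_on_insert)
  then have "\<forall>j\<in>S. x j = 0"
    using insert.prems(1) insert.hyps by (auto simp: inj_on_def)
  moreover from this have "x k *s v k = 0"
    using insert.prems(4) insert.hyps by simp
  ultimately show ?case
    using insert.prems(2)[of k] by (auto simp: vec.scale_eq_0_iff)
qed simp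

lemma eigenbasis:
  fixes M :: "real ^ 'n ^ 'n"
  assumes "distinct_eigenvalues M"
  obtains V :: "complex ^ 'n ^ 'n" and \<mu> where "bij_betw \<mu> UNIV (eigenvalues M)" "invertible V"
    "map_matrix complex_of_real M ** V = V ** diagonal_matrix \<mu>" "\<forall>j. column j V \<noteq> 0"
proof -
  have card: "card (UNIV :: 'n set) = card (eigenvalues M)"
    using assms by (simp add: distinct_eigenvalues_def)
  \<comment> \<open>\<open>card\<close> is 0 on infinite sets, so a positive value also yields
    finiteness.\<close>
  then have "finite (eigenvalues M)"
    by (intro card_ge_0_finite) (simp flip: card add: card_gt_0_iff)
  then obtain \<mu> where \<mu>: "bij_betw \<mu> (UNIV :: 'n set) (eigenvalues M)"
    using finite_same_card_bij[OF finite _ card] by blast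
  then have "\<mu> j \<in> eigenvalues M" for j
    by (auto simp: bij_betw_def)
  then have "\<forall>j. \<exists>v. v \<noteq> 0 \<and> map_matrix complex_of_real M *v v = \<mu> j *s v"
    unfolding eigenvalues_def by blast
  then obtain v where v: "\<And>j. v j \<noteq> 0" "\<And>j. map_matrix complex_of_real M *v v j = \<mu> j *s v j"
    by metis
  define V where "V = (\<chi> i j. v j $ i)"
  have col: "column j V = v j" for j
    by (simp add: V_def column_def)
  have "x = 0" if "V *v x = 0" for x
  proof -
    have "(\<Sum>j\<in>UNIV. x $ j *s v j) = 0"
      using that by (simp add: matrix_mult_sum col)
    then have "\<forall>j\<in>UNIV. x $ j = 0"
      using v bij_betw_imp_inj_on[OF \<mu>] by (intro eigenvectors_independent[of UNIV \<mu> v]) auto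
    then show ?thesis
      by (simp add: vec_eq_iff)
  qed
  then have "invertible V"
    by (simp add: invertible_left_inverse matrix_left_invertible_ker)
  with \<mu> v show ?thesis
    using that[of \<mu> V] by (simp add: matrix_mult_eq_diagonal_iff col)
qed

text \<open>\<open>M'\<close> commutes with its own exponential, which is also that of
  \<open>M\<close> and is diagonal with distinct entries in an eigenbasis of \<open>M\<close>. Hence
  \<open>M'\<close> is diagonal in that basis as well. The moduli of the shared exponentials fix the
  real parts of the eigenvalues, and these determine the traces.\<close>

lemma equal_matrix_exp_imp_commute:
  fixes M M' :: "real ^ 'n ^ 'n"
  assumes "\<Delta> > 0" and cond: "eigenvalue_condition \<Delta> M"
    and same: "matrix_exp (\<Delta> *\<^sub>R M') = matrix_exp (\<Delta> *\<^sub>R M)"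
  shows "M' ** M = M ** M'" and "trace M' = trace M"
proof -
  have "distinct_eigenvalues M"
    using cond by (simp add: eigenvalue_condition_def)
  then obtain V :: "complex ^ 'n ^ 'n" and \<mu> where \<mu>: "bij_betw \<mu> UNIV (eigenvalues M)" and "invertible V"
    and MV: "map_matrix complex_of_real M ** V = V ** diagonal_matrix \<mu>"
    and V: "\<forall>j. column j V \<noteq> 0"
    by (rule eigenbasis) blast
  then obtain U where UV: "U ** V = mat 1" and VU: "V ** U = mat 1"
    by (auto simp: invertible_def)
  let ?c = "map_matrix complex_of_real"
  define E where "E = ?c (matrix_exp (\<Delta> *\<^sub>R M))"
  have exp_col: "?c (matrix_exp (\<Delta> *\<^sub>R N)) *v v = exp (of_real \<Delta> * \<nu>) *s v"
    if "?c N *v v = \<nu> *s v" for N :: "real ^ 'n ^ 'n" and v \<nu>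
  proof (rule matrix_exp_eigenvector)
    have "?c (\<Delta> *\<^sub>R N) *v v = of_real \<Delta> *s (?c N *v v)"
      by (simp add: vec_eq_iff matrix_vector_mult_def sum_distrib_left ac_simps)
    then show "?c (\<Delta> *\<^sub>R N) *v v = (of_real \<Delta> * \<nu>) *s v"
      using that by (simp add: vector_smult_assoc)
  qed
  define e where "e j = exp (of_real \<Delta> * \<mu> j)" for j
  have EV: "E ** V = V ** diagonal_matrix e"
    using MV exp_col unfolding matrix_mult_eq_diagonal_iff E_def e_def by blast
  \<comment> \<open>A coincidence would make \<open>\<mu> i - \<mu> j\<close> one of the excluded
    multiples of \<open>2 pi i / \<Delta>\<close>.\<close>
  have e_inj: "i = j" if e_eq: "e i = e j" for i j
  proof (rule ccontr)
    assume "i \<noteq> j"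
    then have "\<mu> i \<noteq> \<mu> j" "\<mu> i \<in> eigenvalues M" "\<mu> j \<in> eigenvalues M"
      using \<mu> by (auto simp: bij_betw_def inj_def)
    moreover obtain n :: int where "of_real \<Delta> * \<mu> i = of_real \<Delta> * \<mu> j + of_real (of_int (2 * n) * pi) * \<i>"
      using e_eq unfolding e_def exp_eq by blast
    then have "\<mu> i - \<mu> j = of_int n * (2 * of_real pi * \<i> / of_real \<Delta>)"
      using assms(1) by (simp add: field_simps)
    ultimately show False
      using cond unfolding eigenvalue_condition_def by blast
  qed
  \<comment> \<open>\<open>W\<close> represents \<open>M'\<close> in the eigenbasis of
    \<open>M\<close>.\<close>
  define W where "W = U ** ?c M' ** V"
  have MV': "?c M' ** V = V ** W"
    by (metis W_def VU matrix_mul_assoc matrix_mul_lid)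
  have "M' ** matrix_exp (\<Delta> *\<^sub>R M) = matrix_exp (\<Delta> *\<^sub>R M) ** M'"
  proof -
    have "\<Delta> *\<^sub>R (M' ** matrix_exp (\<Delta> *\<^sub>R M)) = \<Delta> *\<^sub>R (matrix_exp (\<Delta> *\<^sub>R M) ** M')"
      using matrix_exp_commute[of "\<Delta> *\<^sub>R M'"] unfolding same
      by (simp add: bounded_bilinear.scaleR_left[OF bounded_bilinear_matrix_mult]
        bounded_bilinear.scaleR_right[OF bounded_bilinear_matrix_mult])
    then show ?thesis
      using assms(1) by simp
  qed
  then have "?c M' ** E = E ** ?c M'"
    unfolding E_def by (simp flip: map_matrix_of_real_mult)
  then have "V ** (W ** diagonal_matrix e) = V ** (diagonal_matrix e ** W)"
    using EV MV' by (metis matrix_mul_assoc)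
  then have "W ** diagonal_matrix e = diagonal_matrix e ** W"
    using UV by (metis matrix_mul_assoc matrix_mul_lid)
  then have "W $ i $ j * e j = e i * W $ i $ j" for i j
    by (metis diagonal_matrix_mult_nth matrix_mult_diagonal_nth)
  then have "W $ i $ j = 0" if "i \<noteq> j" for i j
    using e_inj[of i j] that by (metis mult.commute mult_cancel_left)
  then obtain \<nu> where W: "W = diagonal_matrix \<nu>"
    using that[of "\<lambda>i. W $ i $ i"] by (auto simp: vec_eq_iff diagonal_matrix_def)
  have diag_comm: "diagonal_matrix \<nu> ** diagonal_matrix \<mu> = diagonal_matrix \<mu> ** diagonal_matrix \<nu>"
    by (simp add: vec_eq_iff) (simp add: diagonal_matrix_def)
  have "?c (M' ** M) ** V = ?c (M ** M') ** V"
    unfolding map_matrix_of_real_mult using MV MV' W diag_comm by (metis matrix_mul_assoc)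
  then have "?c (M' ** M) = ?c (M ** M')"
    using VU by (metis matrix_mul_assoc matrix_mul_rid)
  then show "M' ** M = M ** M'"
    by (simp only: map_matrix_of_real_inject)
  have re: "Re (\<nu> j) = Re (\<mu> j)" for j
  proof -
    have "?c M' *v column j V = \<nu> j *s column j V"
      using MV' W by (simp add: matrix_mult_eq_diagonal_iff)
    from exp_col[OF this] have "E *v column j V = exp (of_real \<Delta> * \<nu> j) *s column j V"
      by (simp add: E_def same)
    moreover have "E *v column j V = e j *s column j V"
      using EV by (simp add: matrix_mult_eq_diagonal_iff)
    ultimately have "exp (of_real \<Delta> * \<nu> j) = exp (of_real \<Delta> * \<mu> j)"
      using V by (simp add: e_def vec.scale_right_imp_eq)
    then have "norm (exp (of_real \<Delta> * \<nu> j)) = norm (exp (of_real \<Delta> * \<mu> j))"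
      by simp
    then show ?thesis
      using assms(1) by (simp add: norm_exp_eq_Re)
  qed
  have tr: "trace N = (\<Sum>j\<in>UNIV. Re (d j))" if "?c N ** V = V ** diagonal_matrix d"
    for N :: "real ^ 'n ^ 'n" and d
  proof -
    have "?c N = V ** diagonal_matrix d ** U"
      using that VU by (metis matrix_mul_assoc matrix_mul_rid)
    then have "trace (?c N) = trace (U ** (V ** diagonal_matrix d))"
      by (simp only: trace_mul_sym[of _ U])
    also have "\<dots> = (\<Sum>j\<in>UNIV. d j)"
      using UV by (simp add: matrix_mul_assoc trace_diagonal_matrix)
    finally have "Re (trace (?c N)) = (\<Sum>j\<in>UNIV. Re (d j))"
      by (simp add: Re_sum)
    then show ?thesis
      by (simp add: trace_def)
  qed
  show "trace M' = trace M"
    using tr[OF MV] tr[of M' \<nu>] MV' W re by simp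
qed

subsection \<open>Matrices commuting with the rate matrix of a tree\<close>

text \<open>Generator of the chain whose only jump from \<open>y\<close> leads to
  \<open>p y\<close>, at rate \<open>r y\<close>. Rate 0 makes \<open>y\<close> absorbing, whatever
  \<open>p y\<close> is.\<close>

definition tree_rate_matrix :: "('n \<Rightarrow> 'n) \<Rightarrow> ('n \<Rightarrow> real) \<Rightarrow> real ^ 'n ^ 'n" where
  "tree_rate_matrix p r = (\<chi> y z. r y * (of_bool (z = p y) - of_bool (z = y)))"

text \<open>This is entry \<open>(y, z)\<close> of the commutation relation. It ties
  \<open>D $ y $ z\<close> to the parent of the row index and the children of the column
  index.\<close>

lemma tree_rate_matrix_commute:
  fixes D :: "real ^ 'n ^ 'n"
  assumes "D ** tree_rate_matrix p r = tree_rate_matrix p r ** D"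
  shows "(r y - r z) * D $ y $ z + (\<Sum>w | p w = z. r w * D $ y $ w) = r y * D $ p y $ z"
proof -
  have "(D ** tree_rate_matrix p r) $ y $ z =
      (\<Sum>w\<in>UNIV. (if p w = z then r w * D $ y $ w else 0) - (if w = z then r w * D $ y $ w else 0))"
    by (auto simp: matrix_matrix_mult_def tree_rate_matrix_def intro!: sum.cong)
  also have "\<dots> = (\<Sum>w | p w = z. r w * D $ y $ w) - r z * D $ y $ z"
    by (simp add: sum_subtractf sum.delta sum.If_cases)
  finally have 1: "(D ** tree_rate_matrix p r) $ y $ z = \<dots>" .
  have "(tree_rate_matrix p r ** D) $ y $ z =
      (\<Sum>w\<in>UNIV. (if w = p y then r y * D $ w $ z else 0) - (if w = y then r y * D $ w $ z else 0))"
    by (auto simp: matrix_matrix_mult_def tree_rate_matrix_def intro!: sum.cong)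
  also have "\<dots> = r y * D $ p y $ z - r y * D $ y $ z"
    by (simp add: sum_subtractf)
  finally show ?thesis
    using 1 assms by (simp add: algebra_simps)
qed

text \<open>\<open>depth\<close> only has to fall along edges and need not count them.
  \<open>p root\<close> is arbitrary, which is why \<open>root\<close> is excluded so often
  below.\<close>

locale rooted_tree =
  fixes p :: "'n::finite \<Rightarrow> 'n" and root :: 'n and depth :: "'n \<Rightarrow> nat" and r :: "'n \<Rightarrow> real"
  assumes depth: "y \<noteq> root \<Longrightarrow> depth (p y) < depth y"
    and r_root: "r root = 0" and r_pos: "y \<noteq> root \<Longrightarrow> 0 < r y" and inj_r: "inj r"
begin

text \<open>\<open>anc y z\<close> says that \<open>z\<close> lies on the path from \<open>y\<close>
  to the root, where the path stops.\<close>

inductive anc :: "'n \<Rightarrow> 'n \<Rightarrow> bool" where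
  refl: "anc y y"
| step: "y \<noteq> root \<Longrightarrow> anc (p y) z \<Longrightarrow> anc y z"

lemma anc_root: "anc root z \<longleftrightarrow> z = root"
  by (auto elim: anc.cases intro: anc.refl)

lemma depth_anc: "anc y z \<Longrightarrow> depth z \<le> depth y"
  by (induction rule: anc.induct) (auto dest: depth)

lemma anc_parent: "anc y w \<Longrightarrow> w \<noteq> root \<Longrightarrow> anc y (p w)"
  by (induction rule: anc.induct) (auto intro: anc.intros)

text \<open>Beyond \<open>y\<close> the path has depth at most that of \<open>p y\<close>, which is
  less than that of \<open>w\<close>. Thus a sum over children of \<open>p y\<close> meets the path
  in one term.\<close>

lemma anc_sibling:
  assumes "anc y w" "w \<noteq> root" "p w = p y"
  shows "w = y"
  using assms(1)
proof cases
  case step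
  then show ?thesis
    using depth_anc[OF step(2)] depth[OF assms(2)] assms(3) by simp
qed simp

lemma anc_sibling_parent:
  assumes "anc y w" "w \<noteq> root" "p w = p (p y)" "p y \<noteq> root"
  shows "w = p y"
  using assms(1)
proof cases
  case refl
  then show ?thesis
    using assms(3) depth[OF assms(4)] by simp
next
  case step
  then show ?thesis
    using anc_sibling assms by blast
qed

text \<open>The induction follows the entries linked by the commutation relation. Both moves lower
  \<open>depth y + (N - depth z)\<close>.\<close>

lemma pair_induct:
  assumes "\<And>y z. (y \<noteq> root \<Longrightarrow> P (p y) z) \<Longrightarrow> (\<And>w. p w = z \<Longrightarrow> w \<noteq> root \<Longrightarrow> P y w) \<Longrightarrow> P y z"
  shows "P y z"
proof -
  define N where "N = Max (range depth)"
  have N: "depth x \<le> N" for x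
    by (simp add: N_def)
  show ?thesis
  proof (induction "depth y + (N - depth z)" arbitrary: y z rule: less_induct)
    case less
    show ?case
    proof (rule assms)
      show "P (p y) z" if "y \<noteq> root"
        using less depth[OF that] by simp
      show "P y w" if "p w = z" "w \<noteq> root" for w
        using less[of y w] depth[of w] that N[of w] by simp
    qed
  qed
qed

context
  fixes D :: "real ^ 'n ^ 'n"
  assumes comm: "D ** tree_rate_matrix p r = tree_rate_matrix p r ** D"
begin

lemmas commute_entry = tree_rate_matrix_commute[OF comm]

text \<open>If \<open>z\<close> is off the path from \<open>y\<close>, it is off the path from
  \<open>p y\<close>, and the children of \<open>z\<close> are off the path from \<open>y\<close>.
  By induction only \<open>(r y - r z) * D $ y $ z\<close> is left, and the rates differ.\<close>

lemma commuting_zero_outside_anc: "\<not> anc y z \<Longrightarrow> D $ y $ z = 0"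
proof (induction y z rule: pair_induct)
  case (1 y z)
  have "(\<Sum>w | p w = z. r w * D $ y $ w) = 0"
  proof (intro sum.neutral ballI)
    fix w assume "w \<in> {w. p w = z}"
    then show "r w * D $ y $ w = 0"
      using 1 anc_parent r_root by (cases "w = root") auto
  qed
  moreover have "r y * D $ p y $ z = 0"
    using 1 anc.step r_root by (cases "y = root") auto
  moreover have "r y \<noteq> r z"
    using 1(3) anc.refl injD[OF inj_r, of y z] by auto
  ultimately show ?case
    using commute_entry[of y z] by auto
qed

lemma commute_entry_single:
  assumes "p v = z" "\<And>w. anc y w \<Longrightarrow> w \<noteq> root \<Longrightarrow> p w = z \<Longrightarrow> w = v"
  shows "(r y - r z) * D $ y $ z + r v * D $ y $ v = r y * D $ p y $ z"
proof -
  have "(\<Sum>w | p w = z. r w * D $ y $ w) = (\<Sum>w\<in>{v}. r w * D $ y $ w)"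
    using assms commuting_zero_outside_anc r_root
    by (intro sum.mono_neutral_right) auto
  then show ?thesis
    using commute_entry[of y z] by simp
qed

text \<open>Off the diagonal \<open>r y - r z\<close> is nonzero, so the relation determines each
  entry from those treated earlier in the induction.\<close>

lemma commuting_eq_0_if_diagonal_0:
  assumes "\<And>y. D $ y $ y = 0"
  shows "D = 0"
proof -
  have "D $ y $ z = 0" for y z
  proof (induction y z rule: pair_induct)
    case (1 y z)
    show ?case
    proof (cases "y = z")
      case False
      have "(\<Sum>w | p w = z. r w * D $ y $ w) = 0"
      proof (intro sum.neutral ballI)
        fix w assume "w \<in> {w. p w = z}"
        then show "r w * D $ y $ w = 0"
          using 1 r_root by (cases "w = root") auto
      qed
      moreover have "r y * D $ p y $ z = 0"
        using 1 r_root by (cases "y = root") auto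
      moreover have "r y \<noteq> r z"
        using False injD[OF inj_r, of y z] by auto
      ultimately show ?thesis
        using commute_entry[of y z] by auto
    qed (simp add: assms)
  qed
  then show ?thesis
    by (simp add: vec_eq_iff)
qed

text \<open>
  Vanishing at grandparents makes the ratio of the entries of \<open>D\<close> and of the tree matrix constant
  along edges with a common vertex, and all edges are linked because the root has a single child.
\<close>

lemma commuting_eq_0:
  assumes c: "c \<noteq> root" "p c = root" "\<And>y. y \<noteq> root \<Longrightarrow> p y = root \<Longrightarrow> y = c"
    and grandparent: "\<And>y. y \<noteq> root \<Longrightarrow> p y \<noteq> root \<Longrightarrow> D $ y $ p (p y) = 0"
    and row: "(\<Sum>z\<in>UNIV. D $ root $ z) = 0"
    and trace: "trace D = 0"
  shows "D = 0"
proof -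
  define \<sigma> where "\<sigma> = D $ c $ root / r c"
  have edge: "D $ y $ p y = \<sigma> * r y" if "y \<noteq> root" for y
    using that
  proof (induction "depth y" arbitrary: y rule: less_induct)
    case less
    show ?case
    proof (cases "p y = root")
      case True
      then show ?thesis
        using c less.prems r_pos[of c] by (auto simp: \<sigma>_def)
    next
      case False
      \<comment> \<open>This is the relation at \<open>(y, p (p y))\<close>, whose leading term
        vanishes by \<open>grandparent\<close>.\<close>
      have "r (p y) * D $ y $ p y = r y * D $ p y $ p (p y)"
        using commute_entry_single[of "p y" "p (p y)" y] anc_sibling_parent False
          grandparent[OF less.prems False] by auto
      moreover have "D $ p y $ p (p y) = \<sigma> * r (p y)"
        using less False depth by blast
      ultimately show ?thesis
        using r_pos[OF False] by (simp add: algebra_simps)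
    qed
  qed
  have diag: "D $ y $ y + \<sigma> * r y = D $ root $ root" for y
  proof (induction "depth y" arbitrary: y rule: less_induct)
    case less
    show ?case
    proof (cases "y = root")
      case False
      have "(r y - r (p y)) * D $ y $ p y + r y * D $ y $ y = r y * D $ p y $ p y"
        using commute_entry_single[of y "p y" y] anc_sibling by auto
      then have "r y * (D $ y $ y + \<sigma> * r y) = r y * (D $ p y $ p y + \<sigma> * r (p y))"
        using edge[OF False] by (simp add: algebra_simps)
      then show ?thesis
        using r_pos[OF False] less depth[OF False] by simp
    qed (simp add: r_root)
  qed
  \<comment> \<open>The path from the root is the root alone, so its row reduces to the diagonal
    entry.\<close>
  have "(\<Sum>z\<in>UNIV. D $ root $ z) = (\<Sum>z\<in>{root}. D $ root $ z)"
    using commuting_zero_outside_anc[of root] by (intro sum.mono_neutral_right) (auto simp: anc_root)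
  then have root: "D $ root $ root = 0"
    using row by simp
  have "0 = - \<sigma> * (\<Sum>y\<in>UNIV. r y)"
  proof -
    have "D $ y $ y = - \<sigma> * r y" for y
      using diag[of y] root by simp
    then show ?thesis
      using trace by (simp add: trace_def sum_distrib_left)
  qed
  moreover have "0 < (\<Sum>y\<in>UNIV. r y)"
  proof (rule sum_pos2[of _ c])
    show "0 \<le> r y" for y
      using r_pos[of y] r_root by (cases "y = root") auto
  qed (use c(1) r_pos in auto)
  ultimately have "\<sigma> = 0"
    by auto
  then show ?thesis
    using diag root commuting_eq_0_if_diagonal_0 by simp
qed

end

end

subsection \<open>A tree of configurations\<close>

locale config_tree =
  fixes a b :: "'a::finite" and alt :: "'y::finite"
  assumes a_neq_b: "a \<noteq> b"
begin

text \<open>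
  Under \<open>parent\<close> the configurations form a tree rooted at the all-default one: as long as a person
  outside \<open>{a, b}\<close> is away from the default, one such person is reset, after moving \<open>a\<close> to \<open>alt\<close> if
  both \<open>a\<close> and \<open>b\<close> are at the default. In the remaining plane the steps are
  \<open>(v, o) \<rightarrow> (v, alt)\<close> and \<open>(v, w) \<rightarrow> (alt, w) \<rightarrow> (alt, o) \<rightarrow> (o, o)\<close>.
  Consecutive steps move different people, and only \<open>(alt, o)\<close> leads to the root.
\<close>

definition others :: "('a, 'y) config \<Rightarrow> 'a set" where
  "others y = {d. d \<noteq> a \<and> d \<noteq> b \<and> y d \<noteq> None}"

definition mover :: "('a, 'y) config \<Rightarrow> 'a" where
  "mover y =
     (if others y \<noteq> {} then (if y a = None \<and> y b = None then a else SOME d. d \<in> others y)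
      else if (y a = Some alt) = (y b = None) then a else b)"

definition choice :: "('a, 'y) config \<Rightarrow> 'y option" where
  "choice y =
     (if others y \<noteq> {} then (if y a = None \<and> y b = None then Some alt else None)
      else if y a = Some alt then None else Some alt)"

definition parent :: "('a, 'y) config \<Rightarrow> ('a, 'y) config" where
  "parent y = y(mover y := choice y)"

text \<open>A reset outside \<open>{a, b}\<close> removes 6 and keeps the second summand. Moving
  \<open>a\<close> from the double default lowers 5 to 1, and steps in the plane run through 4, 3,
  2, 1, 0.\<close>

definition height :: "('a, 'y) config \<Rightarrow> nat" where
  "height y = 6 * card (others y) +
     (if y a = None \<and> y b = None then (if others y = {} then 0 else 5)
      else if y b = None then (if y a = Some alt then 1 else 4)
      else if y a = Some alt then 2 else 3)"

lemma others_upd_a [simp]: "others (y(a := v)) = others y"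
  and others_upd_b [simp]: "others (y(b := v)) = others y"
  and others_upd_None: "others (y(d := None)) = others y - {d}"
  by (auto simp: others_def)

text \<open>The three regimes of \<open>parent\<close>. The third replaces the \<open>SOME\<close>
  in \<open>mover\<close> by a named person \<open>d\<close>.\<close>

lemma config_cases:
  fixes y :: "('a, 'y) config"
  obtains (plane) "others y = {}" "y = (\<lambda>_. None)(a := y a, b := y b)"
  | (zero) "others y \<noteq> {}" "y a = None" "y b = None" "mover y = a" "choice y = Some alt"
  | (nonzero) d where "d \<in> others y" "d \<noteq> a" "d \<noteq> b" "y d \<noteq> None" "y a \<noteq> None \<or> y b \<noteq> None"
      "mover y = d" "choice y = None"
proof (cases "others y = {}")
  case True
  then have "y = (\<lambda>_. None)(a := y a, b := y b)"
    by (auto simp: others_def fun_eq_iff)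
  with True show ?thesis
    using plane by blast
next
  case False
  show ?thesis
  proof (cases "y a = None \<and> y b = None")
    case True
    with False show ?thesis
      by (intro zero) (auto simp: mover_def choice_def)
  next
    case ab: False
    have "mover y = (SOME d. d \<in> others y)" "choice y = None"
      using ab False by (auto simp: mover_def choice_def)
    moreover have "(SOME d. d \<in> others y) \<in> others y"
      using False by (simp add: some_in_eq)
    ultimately show ?thesis
      using nonzero[of "mover y"] ab by (simp add: others_def)
  qed
qed

lemma choice_neq: "choice y \<noteq> y (mover y)"
  by (cases y rule: config_cases) (auto simp: mover_def choice_def)

text \<open>Outside the plane every step leaves \<open>a\<close> or \<open>b\<close> away from the
  default, so the root is entered only from within the plane.\<close>

lemma parent_eq_default:
  assumes "y \<noteq> (\<lambda>_. None)" "parent y = (\<lambda>_. None)"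
  shows "y = (\<lambda>_. None)(a := Some alt)"
proof (cases y rule: config_cases)
  case plane
  have "parent y a = None" "parent y b = None"
    using assms(2) by simp_all
  then have "y a = Some alt" "y b = None"
    using plane(1) a_neq_b assms(1) by (auto simp: parent_def mover_def choice_def split: if_splits)
  then have "y = (\<lambda>_. None)(a := Some alt, b := None)"
    using plane(2) by metis
  then show ?thesis
    using a_neq_b by (simp add: fun_upd_twist fun_upd_idem)
next
  case zero
  then have "parent y a = Some alt"
    by (simp add: parent_def)
  then show ?thesis
    using assms(2) by simp
next
  case (nonzero d)
  then have "parent y a \<noteq> None \<or> parent y b \<noteq> None"
    by (auto simp: parent_def)
  then show ?thesis
    using assms(2) by simp
qed

lemma parent_child: "parent ((\<lambda>_. None)(a := Some alt)) = (\<lambda>_. None)"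
  using a_neq_b by (simp add: parent_def mover_def choice_def others_def)

text \<open>In the plane \<open>a\<close> and \<open>b\<close> alternate. Outside it, once
  \<open>a\<close> has moved to \<open>alt\<close> the next mover comes from \<open>others\<close>,
  and a person who was reset has left \<open>others\<close>.\<close>

lemma mover_parent:
  assumes "parent y \<noteq> (\<lambda>_. None)"
  shows "mover (parent y) \<noteq> mover y"
proof (cases y rule: config_cases)
  case plane
  have "\<not> (y a = Some alt \<and> y b = None)"
  proof
    assume "y a = Some alt \<and> y b = None"
    then have "y = (\<lambda>_. None)(a := Some alt, b := None)"
      using plane(2) by metis
    then have "y = (\<lambda>_. None)(a := Some alt)"
      using a_neq_b by (simp add: fun_upd_twist fun_upd_idem)
    then show False
      using assms parent_child by simp
  qed
  then show ?thesis
    using plane(1) a_neq_b by (auto simp: parent_def mover_def choice_def)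
next
  case zero
  then have "parent y = y(a := Some alt)"
    by (simp add: parent_def)
  then have "others (parent y) \<noteq> {}" "parent y a \<noteq> None"
    using zero by auto
  then show ?thesis
    using zero by (cases "parent y" rule: config_cases) auto
next
  case (nonzero d)
  then have p: "parent y = y(d := None)"
    by (simp add: parent_def)
  show ?thesis
  proof (cases "parent y" rule: config_cases)
    case plane
    then show ?thesis
      using nonzero by (auto simp: mover_def)
  qed (use p nonzero in \<open>auto simp: others_upd_None\<close>)
qed

lemma height_parent:
  assumes "y \<noteq> (\<lambda>_. None)"
  shows "height (parent y) < height y"
proof (cases y rule: config_cases)
  case plane
  have "\<not> (y a = None \<and> y b = None)"
  proof
    assume "y a = None \<and> y b = None"
    then have "y = (\<lambda>_. None)(a := None, b := None)"
      using plane(2) by metis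
    then show False
      using assms by (simp add: fun_upd_idem)
  qed
  then show ?thesis
    using plane(1) a_neq_b by (auto simp: parent_def mover_def choice_def height_def)
next
  case zero
  then show ?thesis
    using a_neq_b by (simp add: parent_def height_def)
next
  case (nonzero d)
  then have p: "parent y = y(d := None)"
    by (simp add: parent_def)
  have "card (others (y(d := None))) < card (others y)"
    using nonzero(1) by (metis card_Diff1_less finite others_upd_None)
  then show ?thesis
    using nonzero by (auto simp: p height_def)
qed

text \<open>Two steps by different people do not undo each other, so two components change. This
  supplies the hypothesis \<open>grandparent\<close> of \<open>commuting_eq_0\<close>.\<close>

lemma parent_grandparent_differ:
  assumes "parent y \<noteq> (\<lambda>_. None)"
  shows "\<not> (\<exists>!d. parent (parent y) d \<noteq> y d)"
proof -
  have "parent (parent y) (mover y) \<noteq> y (mover y)"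
    using choice_neq[of y] mover_parent[OF assms] by (simp add: parent_def)
  moreover have "parent (parent y) (mover (parent y)) \<noteq> y (mover (parent y))"
    using choice_neq[of "parent y"] mover_parent[OF assms] by (simp add: parent_def)
  ultimately show ?thesis
    using mover_parent[OF assms] by blast
qed

end

subsection \<open>Generic identification\<close>

lemma transition_rate_upd:
  assumes "v \<noteq> y a"
  shows "transition_rate rate P (y(a := v)) y = rate a * P a v y"
proof -
  have "(y(a := v)) d \<noteq> y d \<longleftrightarrow> d = a" for d
    using assms by simp
  then show ?thesis
    by (simp add: transition_rate_def)
qed

lemma rate_matrix_nonadjacent:
  assumes "z \<noteq> y" "\<not> (\<exists>!a. z a \<noteq> y a)"
  shows "rate_matrix rate P $ y $ z = 0"
  using assms by (simp add: rate_matrix_def transition_rate_def)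

lemma rate_matrix_row_sum: "(\<Sum>z\<in>UNIV. rate_matrix rate P $ y $ z) = 0"
proof -
  have "(\<Sum>z\<in>UNIV. rate_matrix rate P $ y $ z) =
      rate_matrix rate P $ y $ y + (\<Sum>z\<in>UNIV - {y}. rate_matrix rate P $ y $ z)"
    by (simp add: sum.remove)
  also have "(\<Sum>z\<in>UNIV - {y}. rate_matrix rate P $ y $ z) = (\<Sum>z\<in>UNIV - {y}. transition_rate rate P z y)"
    by (intro sum.cong) (auto simp: rate_matrix_def)
  finally show ?thesis
    by (simp add: rate_matrix_def)
qed

text \<open>Off-diagonal entries reveal \<open>P a v y\<close> for \<open>v \<noteq> y a\<close>.
  The probability of keeping the current option follows from normalisation.\<close>

lemma rate_matrix_inject:
  assumes rate: "\<And>a. rate a \<noteq> 0"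
    and sums: "\<And>a y. (\<Sum>v\<in>UNIV. P a v y) = 1" "\<And>a y. (\<Sum>v\<in>UNIV. P' a v y) = 1"
    and eq: "rate_matrix rate P = rate_matrix rate P'"
  shows "P = P'"
proof -
  have move: "P a v y = P' a v y" if "v \<noteq> y a" for a v y
  proof -
    have "y(a := v) \<noteq> y"
      using that by (metis fun_upd_same)
    then have "transition_rate rate P (y(a := v)) y = transition_rate rate P' (y(a := v)) y"
      using arg_cong[OF eq, of "\<lambda>M. M $ y $ (y(a := v))"] by (simp add: rate_matrix_def)
    then show ?thesis
      using that rate by (simp add: transition_rate_upd)
  qed
  have "P a (y a) y = P' a (y a) y" for a y
  proof -
    have "(\<Sum>v\<in>UNIV - {y a}. P a v y) = (\<Sum>v\<in>UNIV - {y a}. P' a v y)"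
      by (intro sum.cong) (auto simp: move)
    then show ?thesis
      using sums[of a y] by (simp add: sum.remove[of _ "y a"])
  qed
  then have "P a v y = P' a v y" for a v y
    using move by (cases "v = y a") auto
  then show ?thesis
    by (simp add: fun_eq_iff)
qed

text \<open>Extends the inverse of \<open>profile_coords\<close> to all real vectors. Normalisation
  is kept and positivity dropped, so polynomial arguments apply on the whole space.\<close>

definition profile_of_coords ::
    "real ^ ('a::finite \<times> 'y::finite \<times> ('a, 'y) config) \<Rightarrow> ('a, 'y) profile" where
  "profile_of_coords x a v y =
     (case v of None \<Rightarrow> 1 - (\<Sum>w\<in>UNIV. x $ (a, w, y)) | Some w \<Rightarrow> x $ (a, w, y))"

lemma profile_of_coords_profile_coords:
  assumes "\<And>a y. (\<Sum>v\<in>UNIV. P a v y) = 1"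
  shows "profile_of_coords (profile_coords P) = P"
proof -
  have "(\<Sum>v\<in>UNIV. P a v y) = P a None y + (\<Sum>w\<in>UNIV. P a (Some w) y)" for a y
    by (simp add: UNIV_option_conv sum.reindex)
  then have "1 - (\<Sum>w\<in>UNIV. P a (Some w) y) = P a None y" for a y
    using assms[of a y] by simp
  then show ?thesis
    by (auto simp: fun_eq_iff profile_of_coords_def profile_coords_def split: option.split)
qed

lemma real_polynomial_function_nth: "real_polynomial_function (\<lambda>x :: real ^ 'n. x $ i)"
  by (intro real_polynomial_function.intros(1) bounded_linear_vec_nth)

lemma real_polynomial_function_rate_matrix:
  "real_polynomial_function (\<lambda>x. rate_matrix rate (profile_of_coords x) $ y $ z)"
proof -
  have P: "real_polynomial_function (\<lambda>x. profile_of_coords x a v y)" for a v y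
    by (cases v) (auto simp: profile_of_coords_def intro!: real_polynomial_function_diff
        real_polynomial_function_sum real_polynomial_function_nth real_polynomial_function.intros(2))
  have t: "real_polynomial_function (\<lambda>x. transition_rate rate (profile_of_coords x) z y)" for z y
    by (cases "\<exists>!a. z a \<noteq> y a")
      (simp_all only: transition_rate_def Let_def if_True if_False
        real_polynomial_function.intros(2) real_polynomial_function.intros(4) P)
  show ?thesis
    by (cases "z = y")
      (auto simp: rate_matrix_def intro!: t real_polynomial_function_minus real_polynomial_function_sum)
qed

lemma polynomial_function_matrix:
  fixes A :: "'p::real_normed_vector \<Rightarrow> real ^ 'n ^ 'm"
  assumes "\<And>i j. real_polynomial_function (\<lambda>p. A p $ i $ j)"
  shows "polynomial_function A"
  using assms by (auto simp: polynomial_function_iff_Basis_inner Basis_vec_def inner_axis)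

text \<open>In \<open>commutation_system\<close> only the first component depends on the
  profile.\<close>

lemma polynomial_function_Pair_const:
  assumes "polynomial_function f"
  shows "polynomial_function (\<lambda>p. (f p, c))"
  unfolding polynomial_function_def
proof (intro allI impI)
  fix h :: "'b \<times> 'c \<Rightarrow> real"
  assume h: "bounded_linear h"
  have "bounded_linear (\<lambda>u. h (u, 0))"
    by (intro bounded_linear_compose[OF h] bounded_linear_Pair bounded_linear_ident bounded_linear_zero)
  then have "real_polynomial_function (\<lambda>p. h (f p, 0) + h (0, c))"
    using assms unfolding polynomial_function_def o_def
    by (intro real_polynomial_function.intros(2,3)) auto
  moreover have "h (f p, c) = h (f p, 0) + h (0, c)" for p
    using linear_add[OF bounded_linear.linear[OF h], of "(f p, 0)" "(0, c)"] by simp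
  ultimately show "real_polynomial_function (h \<circ> (\<lambda>p. (f p, c)))"
    by (simp add: o_def)
qed

text \<open>Flattened coordinates give the unknown matrix the vector type on which the determinant
  argument runs.\<close>

definition matrix_of_coords :: "real ^ ('n \<times> 'n) \<Rightarrow> real ^ 'n ^ 'n" where
  "matrix_of_coords u = (\<chi> y z. u $ (y, z))"

text \<open>
  Its kernel is the set of trace zero matrices that commute with \<open>M\<close>, have zero row sums and vanish
  at pairs of configurations that differ in more than one component.
\<close>

definition commutation_system ::
    "real ^ ('a::finite, 'y::finite) config ^ ('a, 'y) config \<Rightarrow>
     real ^ (('a, 'y) config \<times> ('a, 'y) config) \<Rightarrow>
     (real ^ ('a, 'y) config ^ ('a, 'y) config) \<times>
     (real ^ ('a, 'y) config ^ ('a, 'y) config) \<times> (real ^ ('a, 'y) config) \<times> real" where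
  "commutation_system M u = (let D = matrix_of_coords u in
     (D ** M - M ** D, \<chi> y z. if z = y \<or> (\<exists>!a. z a \<noteq> y a) then 0 else D $ y $ z,
      \<chi> y. \<Sum>z\<in>UNIV. D $ y $ z, trace D))"

lemma commutation_system_eq_0_iff:
  "commutation_system M u = 0 \<longleftrightarrow> (let D = matrix_of_coords u in
     D ** M = M ** D \<and> (\<forall>y z. z \<noteq> y \<longrightarrow> \<not> (\<exists>!a. z a \<noteq> y a) \<longrightarrow> D $ y $ z = 0) \<and>
     (\<forall>y. (\<Sum>z\<in>UNIV. D $ y $ z) = 0) \<and> trace D = 0)"
  unfolding commutation_system_def Let_def zero_prod_def by (simp add: vec_eq_iff imp_conjL)

lemma linear_commutation_system: "linear (commutation_system M)"
  by (auto simp: linear_iff commutation_system_def matrix_of_coords_def Let_def vec_eq_iff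
      matrix_matrix_mult_def trace_def algebra_simps sum.distrib sum_distrib_left)

lemma polynomial_function_commutation_system:
  "polynomial_function (\<lambda>x. commutation_system (rate_matrix rate (profile_of_coords x)) u)"
  unfolding commutation_system_def Let_def
  by (intro polynomial_function_Pair_const polynomial_function_matrix)
    (auto simp: matrix_matrix_mult_def intro!: real_polynomial_function_diff real_polynomial_function_sum
      real_polynomial_function.intros(2) real_polynomial_function.intros(4) real_polynomial_function_rate_matrix)

context config_tree
begin

lemma rate_matrix_parent:
  fixes r :: "('a, 'y) config \<Rightarrow> real" and rate :: "'a \<Rightarrow> real"
  assumes rate: "\<And>a. rate a \<noteq> 0"
  obtains P where "\<And>a y. (\<Sum>v\<in>UNIV. P a v y) = 1" "rate_matrix rate P = tree_rate_matrix parent r"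
proof -
  define q where "q a v y = (if a = mover y \<and> v = choice y then r y / rate a else 0)" for a v y
  \<comment> \<open>The entry for keeping the current option never enters the rate matrix, so it can
    absorb the normalisation, possibly with a negative value.\<close>
  define P where "P a v y = (if v = y a then 1 - (\<Sum>v\<in>UNIV - {y a}. q a v y) else q a v y)" for a v y
  have "(\<Sum>v\<in>UNIV. P a v y) = P a (y a) y + (\<Sum>v\<in>UNIV - {y a}. P a v y)" for a y
    by (simp add: sum.remove)
  moreover have "(\<Sum>v\<in>UNIV - {y a}. P a v y) = (\<Sum>v\<in>UNIV - {y a}. q a v y)" for a y
    by (intro sum.cong) (auto simp: P_def)
  ultimately have sums: "(\<Sum>v\<in>UNIV. P a v y) = 1" for a y
    by (simp add: P_def)
  have parent_neq: "parent y \<noteq> y" for y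
    using choice_neq[of y] by (metis fun_upd_same parent_def)
  have trans: "transition_rate rate P z y = r y * of_bool (z = parent y)" if "z \<noteq> y" for y z
  proof (cases "\<exists>!a. z a \<noteq> y a")
    case True
    then obtain a where a: "z a \<noteq> y a" "\<And>d. d \<noteq> a \<Longrightarrow> z d = y d"
      by blast
    then have z: "z = y(a := z a)"
      by auto
    have "z = parent y \<longleftrightarrow> a = mover y \<and> z a = choice y"
    proof
      assume "z = parent y"
      with a(1) show "a = mover y \<and> z a = choice y"
        by (auto simp: parent_def split: if_splits)
    next
      assume "a = mover y \<and> z a = choice y"
      with z show "z = parent y"
        by (metis parent_def)
    qed
    moreover have "transition_rate rate P z y = rate a * P a (z a) y"
      using transition_rate_upd[of "z a" y a rate P] a(1) z by simp
    ultimately show ?thesis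
      using a(1) rate by (auto simp: P_def q_def)
  next
    case False
    have "\<exists>!a. parent y a \<noteq> y a"
      using choice_neq[of y] by (intro ex1I[of _ "mover y"]) (auto simp: parent_def split: if_splits)
    with False have "z \<noteq> parent y"
      by blast
    then show ?thesis
      using False by (simp add: transition_rate_def)
  qed
  have "(\<Sum>z\<in>UNIV - {y}. transition_rate rate P z y) = r y" for y
  proof -
    have "(\<Sum>z\<in>UNIV - {y}. transition_rate rate P z y) = (\<Sum>z\<in>UNIV - {y}. if z = parent y then r y else 0)"
      by (intro sum.cong) (auto simp: trans)
    then show ?thesis
      using parent_neq by simp
  qed
  then have "rate_matrix rate P = tree_rate_matrix parent r"
    using trans parent_neq parent_neq[symmetric] by (auto simp: vec_eq_iff rate_matrix_def tree_rate_matrix_def)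
  with sums show ?thesis
    using that by blast
qed

lemma inj_commutation_system:
  fixes rate :: "'a \<Rightarrow> real"
  assumes "\<And>a. rate a \<noteq> 0"
  obtains x :: "real ^ ('a \<times> 'y \<times> ('a, 'y) config)"
  where "inj (commutation_system (rate_matrix rate (profile_of_coords x)))"
proof -
  let ?root = "(\<lambda>_. None) :: ('a, 'y) config"
  obtain f :: "('a, 'y) config \<Rightarrow> nat" where f: "inj f"
    using finite_imp_inj_to_nat_seg[of "UNIV :: ('a, 'y) config set"] by auto
  \<comment> \<open>\<open>Suc\<close> keeps the rates away from the root positive, hence also
    different from the rate 0 of the root.\<close>
  define r where "r y = (if y = ?root then 0 else real (Suc (f y)))" for y
  interpret rooted_tree parent ?root height r
    using f by unfold_locales (auto simp: r_def height_parent inj_def)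
  obtain P where P: "\<And>a y. (\<Sum>v\<in>UNIV. P a v y) = 1" "rate_matrix rate P = tree_rate_matrix parent r"
    using rate_matrix_parent[of rate r] assms by blast
  let ?M = "rate_matrix rate (profile_of_coords (profile_coords P))"
  have M: "?M = tree_rate_matrix parent r"
    using P by (simp add: profile_of_coords_profile_coords)
  have "u = 0" if "commutation_system ?M u = 0" for u
  proof -
    define D where "D = matrix_of_coords u"
    have D: "D ** ?M = ?M ** D" "\<And>y z. z \<noteq> y \<Longrightarrow> \<not> (\<exists>!a. z a \<noteq> y a) \<Longrightarrow> D $ y $ z = 0"
        "\<And>y. (\<Sum>z\<in>UNIV. D $ y $ z) = 0" "trace D = 0"
      using that by (auto simp: commutation_system_eq_0_iff D_def Let_def)
    have "D = 0"
    proof (rule commuting_eq_0)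
      show "D ** tree_rate_matrix parent r = tree_rate_matrix parent r ** D"
        using D(1) M by simp
      show "?root(a := Some alt) \<noteq> ?root"
        by (metis fun_upd_same option.distinct(1))
      show "parent (?root(a := Some alt)) = ?root"
        by (rule parent_child)
      show "y = ?root(a := Some alt)" if "y \<noteq> ?root" "parent y = ?root" for y
        using parent_eq_default that by blast
      show "D $ y $ parent (parent y) = 0" if "y \<noteq> ?root" "parent y \<noteq> ?root" for y
      proof (rule D(2))
        show "parent (parent y) \<noteq> y"
          using depth[OF that(1)] depth[OF that(2)] by auto
      qed (rule parent_grandparent_differ[OF that(2)])
    qed (rule D)+
    then show ?thesis
      by (simp add: D_def matrix_of_coords_def vec_eq_iff)
  qed
  then have "inj (commutation_system ?M)"
    by (simp add: linear_injective_0[OF linear_commutation_system])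
  then show ?thesis
    using that by blast
qed

end

theorem proposition4p3:
  fixes network :: "('a::finite \<times> 'a) set"
    and \<Delta> :: real
    and rate :: "'a \<Rightarrow> real"
  assumes "\<Delta> > 0"
    and "irrefl network"
    and "\<And>a. card (friends network a) > 0"
    and "\<And>a. rate a > 0"
  shows "\<exists>E :: (real ^ ('a \<times> 'y::finite \<times> ('a, 'y) config)) set. E \<in> null_sets lebesgue \<and>
    (\<forall>P \<in> admissible_profiles \<Delta> rate. profile_coords P \<notin> E \<longrightarrow>
      (\<forall>P' \<in> admissible_profiles \<Delta> rate.
        matrix_exp (\<Delta> *\<^sub>R rate_matrix rate P') = matrix_exp (\<Delta> *\<^sub>R rate_matrix rate P) \<longrightarrow> P' = P))"
proof -
  let ?M = "\<lambda>x. rate_matrix rate (profile_of_coords x :: ('a, 'y) profile)"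
  define E where "E = {x. \<not> inj (commutation_system (?M x))}"
  have rate: "rate a \<noteq> 0" for a
    using assms(4)[of a] by simp
  have "friends network undefined \<noteq> {}"
    using assms(3)[of undefined] by auto
  \<comment> \<open>A friend provides the second person required for consecutive steps to have
    different movers.\<close>
  then obtain a b :: 'a where "b \<in> friends network a"
    by blast
  then interpret config_tree a b "undefined :: 'y"
    by unfold_locales (auto simp: friends_def)
  obtain x0 where "inj (commutation_system (?M x0))"
    using inj_commutation_system[of rate] rate by blast
  then have "negligible E"
    unfolding E_def
    by (intro negligible_not_inj_polynomial_family linear_commutation_system
        polynomial_function_commutation_system)
  moreover have "P' = P"
    if P: "P \<in> admissible_profiles \<Delta> rate" "profile_coords P \<notin> E" and P': "P' \<in> admissible_profiles \<Delta> rate"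
      and exp: "matrix_exp (\<Delta> *\<^sub>R rate_matrix rate P') = matrix_exp (\<Delta> *\<^sub>R rate_matrix rate P)"
    for P P' :: "('a, 'y) profile"
  proof -
    have sums: "(\<Sum>v\<in>UNIV. P a v y) = 1" "(\<Sum>v\<in>UNIV. P' a v y) = 1" for a y
      using P(1) P' by (auto simp: admissible_profiles_def ccp_profile_def)
    define D where "D = rate_matrix rate P' - rate_matrix rate P"
    define u where "u = (\<chi> i. D $ fst i $ snd i)"
    have u: "matrix_of_coords u = D"
      by (simp add: matrix_of_coords_def u_def vec_eq_iff)
    have cond: "eigenvalue_condition \<Delta> (rate_matrix rate P)"
      using P(1) by (simp add: admissible_profiles_def)
    note commute = equal_matrix_exp_imp_commute[OF assms(1) cond exp]
    have "commutation_system (rate_matrix rate P) u = 0"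
      unfolding commutation_system_eq_0_iff Let_def u
    proof (intro conjI allI impI)
      show "D ** rate_matrix rate P = rate_matrix rate P ** D"
        using commute(1) by (simp add: D_def bounded_bilinear.diff_left[OF bounded_bilinear_matrix_mult]
            bounded_bilinear.diff_right[OF bounded_bilinear_matrix_mult])
    qed (auto simp: D_def rate_matrix_nonadjacent sum_subtractf rate_matrix_row_sum trace_sub commute(2))
    moreover have "inj (commutation_system (rate_matrix rate P))"
      using P(2) by (simp add: E_def profile_of_coords_profile_coords sums)
    ultimately have "u = 0"
      by (simp add: linear_injective_0[OF linear_commutation_system])
    then have "D = 0"
      using u by (simp add: matrix_of_coords_def vec_eq_iff)
    then show ?thesis
      using rate sums by (intro rate_matrix_inject[of rate P' P]) (auto simp: D_def)
  qed
  ultimately show ?thesis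
    by (auto simp: negligible_iff_null_sets)
qed

end
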